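(* For Lebesgue-almost every $(d_1,d_2,d_3)\in(0,1)^3$, the triangle process with decision points $d_1,d_2,d_3$ has only finitely many periodic orbits, every trajectory $(z(t))_{t\ge0}$ is eventually periodic, and every trajectory converges onto one of these periodic orbits as $t\to\infty$.
   Context: Triangle process. Fix $\lambda_1,\lambda_2,\lambda_3>0$, $\mu_1,\mu_2,\mu_3>0$ with $\rho_i:=\lambda_i/\mu_i<1$ for each $i$ and $\rho_1+\rho_2+\rho_3>1$. Put $\theta_j:=\mu_j^{-1}(\lambda_1+\lambda_2+\lambda_3)-1$. Let $e_1,e_2,e_3$ be the standard basis of $\mathbb R^3$, $A_i^0:=\{y\in\mathbb R^3: y_1+y_2+y_3=1,\ y_i=0,\ y_l\ge0\ \forall l\}$ and $A^0:=A_1^0\cup A_2^0\cup A_3^0$. For $j\in\{1,2,3\}$ and $z\in A^0\setminus A_j^0$ let $f_j(z):=\sum_{i\neq j}\frac{(\mu_j-\lambda_j)z_i+\lambda_i z_j}{(\mu_j-\lambda_j)+\mu_j\theta_j z_j}\,e_i\in A_j^0$. Let $(\hat i,\hat j,\hat k)$ denote $(1,2,3)$ or one of its cyclic permutations; the point $(1-x)e_{\hat j}+xe_{\hat k}\in A^0_{\hat i}$, $x\in[0,1]$, is written $(x,\hat i)$, with $\pi((x,\hat i)):=x$ and $\mathrm{Side}((x,\hat i)):=\hat i$. Distance: $|z-z'|_1:=\|z-z'\|/\sqrt2$ (Euclidean norm). Decision points are numbers $d_1,d_2,d_3\in(0,1)$, identified with the points $(d_{\hat i},\hat i)\in A^0_{\hat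 i}$. The switching rule is $\mathfrak R((x,\hat i))=\hat j$ if $x<d_{\hat i}$, $=\hat k$ if $x>d_{\hat i}$, and both values $\hat j,\hat k$ are allowed if $x=d_{\hat i}$. The (possibly two-valued at decision points) map is $\varphi(z):=f_{\mathfrak R(z)}(z)$. A trajectory is a sequence $(z(t))_{t\ge0}$ in $A^0$ with $z(t+1)\in\varphi(z(t))$ for all $t$. A periodic orbit is a finite sequence $u_1,\dots,u_m$ with $u_{n+1}\in\varphi(u_n)$ for $n<m$ and $u_1\in\varphi(u_m)$ (cyclic shifts are the same orbit). A trajectory is eventually $m$-periodic if there is $N$ with $\mathrm{Side}(z(n+m))=\mathrm{Side}(z(n))$ for all $n\ge N$; eventually periodic if this holds for some $m\ge1$; nonperiodic otherwise. A trajectory converges onto the orbit $u_1,\dots,u_m$ if there is $n_0\ge0$ with $|z(mt+n+n_0)-u_n|_1\to0$ as $t\to\infty$ for each $n=1,\dots,m$. *)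

theory Defs
  imports "HOL-Analysis.Analysis"
begin

text \<open>Points of the triangle live in real^3; indices are of the numeral type 3,
  whose elements 1, 2, 3 (= 0) are the paper's indices 1, 2, 3.  The cyclic
  permutations (i,j,k) of (1,2,3) are exactly (i, i+1, i+2) in this type.\<close>

type_synonym pt3 = "real ^ 3"

definition ebasis :: "3 \<Rightarrow> pt3" where
  "ebasis i = axis i 1"

definition A0i :: "3 \<Rightarrow> pt3 set" where
  "A0i i = {y. y$1 + y$2 + y$3 = 1 \<and> y$i = 0 \<and> (\<forall>l. y$l \<ge> 0)}"

definition A0 :: "pt3 set" where
  "A0 = A0i 1 \<union> A0i 2 \<union> A0i 3"

definition theta :: "pt3 \<Rightarrow> pt3 \<Rightarrow> 3 \<Rightarrow> real" where
  "theta lam mu j = (lam$1 + lam$2 + lam$3) / mu$j - 1"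

text \<open>The map f_j (only ever applied to z in A0 minus A0i j).\<close>
definition fmap :: "pt3 \<Rightarrow> pt3 \<Rightarrow> 3 \<Rightarrow> pt3 \<Rightarrow> pt3" where
  "fmap lam mu j z = (\<Sum>i\<in>UNIV - {j}.
     (((mu$j - lam$j) * z$i + lam$i * z$j) / ((mu$j - lam$j) + mu$j * theta lam mu j * z$j))
       *\<^sub>R ebasis i)"

definition sidept :: "real \<Rightarrow> 3 \<Rightarrow> pt3" where
  "sidept x i = (1 - x) *\<^sub>R ebasis (i + 1) + x *\<^sub>R ebasis (i + 2)"

text \<open>Switching rule as a relation: rule d z j holds iff j is an allowed value of R(z).\<close>
definition rule :: "pt3 \<Rightarrow> pt3 \<Rightarrow> 3 \<Rightarrow> bool" where
  "rule d z j \<longleftrightarrow> (\<exists>i x. 0 \<le> x \<and> x \<le> 1 \<and> z = sidept x i \<and>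
      ((x < d$i \<and> j = i + 1) \<or> (x > d$i \<and> j = i + 2) \<or>
       (x = d$i \<and> (j = i + 1 \<or> j = i + 2))))"

definition phi :: "pt3 \<Rightarrow> pt3 \<Rightarrow> pt3 \<Rightarrow> pt3 \<Rightarrow> pt3 set" where
  "phi lam mu d z = {fmap lam mu j z | j. rule d z j}"

definition trajectory :: "pt3 \<Rightarrow> pt3 \<Rightarrow> pt3 \<Rightarrow> (nat \<Rightarrow> pt3) \<Rightarrow> bool" where
  "trajectory lam mu d z \<longleftrightarrow> (\<forall>t. z t \<in> A0 \<and> z (Suc t) \<in> phi lam mu d (z t))"

definition periodic_orbit :: "pt3 \<Rightarrow> pt3 \<Rightarrow> pt3 \<Rightarrow> pt3 list \<Rightarrow> bool" where
  "periodic_orbit lam mu d us \<longleftrightarrow> us \<noteq> [] \<and>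
     (\<forall>n. Suc n < length us \<longrightarrow> us ! Suc n \<in> phi lam mu d (us ! n)) \<and>
     hd us \<in> phi lam mu d (last us)"

text \<open>A periodic orbit is primitive if it is not a repetition of a shorter one
  (repetitions describe the same orbit).\<close>
definition primitive_list :: "'a list \<Rightarrow> bool" where
  "primitive_list us \<longleftrightarrow> \<not> (\<exists>k ws. k \<ge> 2 \<and> us = concat (replicate k ws))"

text \<open>The set of sides containing a point (a singleton except at the corners).\<close>
definition Sides :: "pt3 \<Rightarrow> 3 set" where
  "Sides z = {i. z \<in> A0i i}"

definition eventually_m_periodic :: "nat \<Rightarrow> (nat \<Rightarrow> pt3) \<Rightarrow> bool" where
  "eventually_m_periodic m z \<longleftrightarrow> (\<exists>N. \<forall>n\<ge>N. Sides (z (n + m)) = Sides (z n))"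

definition eventually_periodic :: "(nat \<Rightarrow> pt3) \<Rightarrow> bool" where
  "eventually_periodic z \<longleftrightarrow> (\<exists>m\<ge>1. eventually_m_periodic m z)"

definition dist1 :: "pt3 \<Rightarrow> pt3 \<Rightarrow> real" where
  "dist1 z z' = norm (z - z') / sqrt 2"

definition converges_onto :: "(nat \<Rightarrow> pt3) \<Rightarrow> pt3 list \<Rightarrow> bool" where
  "converges_onto z us \<longleftrightarrow> (\<exists>n0. \<forall>n < length us.
     ((\<lambda>t. dist1 (z (length us * t + n + n0)) (us ! n)) \<longlonglongrightarrow> 0))"

end

theory Submission
  imports Defs
begin

text \<open>
  On side \<open>i\<close> use the log-odds \<open>u = ln ((1 - x) / x)\<close> as coordinate. In it each branch of the
  map becomes \<open>u \<mapsto> \<plusminus> ln (p + q exp (\<mp> u))\<close> up to a constant, which is a contraction, uniformly as long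
  as the decision points stay in a compact part of \<open>(0,1)\<close>; moreover the whole map is injective.

  By injectivity at most three of the words of length \<open>k\<close> that occur can be continued in two ways, so
  at most \<open>3 (k + 1)\<close> words of length \<open>k\<close> occur, while each contracts by \<open>c ^ k\<close>.
  Fix \<open>k\<close> with \<open>3 (k + 1) c ^ k < 1\<close>. For a fixed set \<open>W\<close> of at most \<open>3 (k + 1)\<close> words of length \<open>k\<close>,
  the points reachable by arbitrarily long concatenations of words in \<open>W\<close> form a null set which does
  not depend on the decision points. There are only finitely many such \<open>W\<close>, hence for almost every
  choice of decision points none of them lies in the null set of its own \<open>W\<close>.

  Then all trajectories eventually keep a distance \<open>\<epsilon>\<close> from the decision points, so two
  states of a trajectory on the same side less than \<open>\<epsilon>\<close> apart have the same future itinerary and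
  their distance tends to 0; the pigeonhole principle yields periodicity and finiteness.
\<close>

section \<open>Injective systems of contracting branches\<close>

definition nx :: "3 \<Rightarrow> bool \<Rightarrow> 3" where
  "nx i b = (if b then i + 1 else i + 2)"

lemma nx_inject [simp]: "nx i b = nx i b' \<longleftrightarrow> b = b'"
  using exhaust_3[of i] by (auto simp: nx_def)

text \<open>Both inequalities are weak: at the decision point either choice is allowed, and
  admissibility survives limits.\<close>

definition ok :: "real \<Rightarrow> bool \<Rightarrow> real \<Rightarrow> bool" where
  "ok e b u \<longleftrightarrow> (if b then e \<le> u else u \<le> e)"

text \<open>Words are lists of choices with the most recent choice at the head.\<close>
fun side :: "3 \<Rightarrow> bool list \<Rightarrow> 3" where
  "side i [] = i"
| "side i (b # bs) = nx (side i bs) b"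

lemma finite_words: "finite {(i :: 3, bs :: bool list). length bs = k}"
proof -
  have "{(i :: 3, bs :: bool list). length bs = k} = UNIV \<times> {bs. set bs \<subseteq> UNIV \<and> length bs = k}"
    by auto
  then show ?thesis
    by (simp only:) (intro finite_cartesian_product finite_lists_length_eq finite)
qed

text \<open>\<open>lip\<close> and \<open>bound\<close> hold on the whole line, so that a word can
  be run from any state whatever the decision points are. \<open>inj\<close> is asked only on the
  half-line cut off by a decision point. Each side is entered by exactly two branches, one for
  either choice; \<open>disj\<close> keeps their images apart.\<close>

locale contracting_branches =
  fixes g :: "3 \<Rightarrow> bool \<Rightarrow> real \<Rightarrow> real" and c L M :: real
  assumes c: "0 < c" "c < 1"
    and lip: "\<And>i b u v. \<bar>g i b u - g i b v\<bar> \<le> c * \<bar>u - v\<bar>"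
    and bound: "\<And>i b u. \<bar>g i b u\<bar> \<le> L"
    and inj: "\<And>i b e u v. \<bar>e\<bar> \<le> M \<Longrightarrow> ok e b u \<Longrightarrow> ok e b v \<Longrightarrow> g i b u = g i b v \<Longrightarrow> u = v"
    and disj: "\<And>i j u v. i + 1 = j + 2 \<Longrightarrow> g i True u \<noteq> g j False v"
begin

section \<open>Running words, and covers by small intervals\<close>

lemma L_nonneg: "0 \<le> L"
  using bound[of 0 True 0] by linarith

lemma continuous_on_g: "continuous_on S (g i b)"
proof -
  have "c-lipschitz_on S (g i b)"
    using c lip by (intro lipschitz_onI) (auto simp: dist_real_def)
  then show ?thesis by (rule lipschitz_on_continuous_on)
qed

text \<open>Admissibility is ignored on purpose: \<open>run\<close>, and hence
  \<open>centers W n\<close>, does not depend on the decision points.\<close>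

fun run :: "3 \<Rightarrow> bool list \<Rightarrow> real \<Rightarrow> real" where
  "run i [] u = u"
| "run i (b # bs) u = g (side i bs) b (run i bs u)"

lemma run_lip: "\<bar>run i bs u - run i bs v\<bar> \<le> c ^ length bs * \<bar>u - v\<bar>"
proof (induction bs)
  case (Cons b bs)
  have "\<bar>run i (b # bs) u - run i (b # bs) v\<bar> \<le> c * \<bar>run i bs u - run i bs v\<bar>"
    using lip by simp
  also have "\<dots> \<le> c * (c ^ length bs * \<bar>u - v\<bar>)"
    using Cons c by (intro mult_left_mono) auto
  finally show ?case by (simp add: mult.assoc)
qed simp

text \<open>Centers of intervals of radius \<open>c ^ (k * n) * L\<close> which cover the states reachable
  by \<open>n\<close> successive words taken from \<open>W\<close>, all of length \<open>k\<close>.\<close>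
fun centers :: "(3 \<times> bool list) set \<Rightarrow> nat \<Rightarrow> (3 \<times> real) set" where
  "centers W 0 = UNIV \<times> {0}"
| "centers W (Suc n) =
    (\<lambda>((i, bs), (j, x)). (side i bs, run i bs x)) ` {(w, y) \<in> W \<times> centers W n. fst w = fst y}"

lemma finite_centers: "finite W \<Longrightarrow> finite (centers W n)"
proof (induction n)
  case (Suc n)
  then have "finite {(w, y) \<in> W \<times> centers W n. fst w = fst y}"
    by - (rule finite_subset[where B = "W \<times> centers W n"], auto)
  then show ?case unfolding centers.simps by (rule finite_imageI)
qed simp

lemma card_centers:
  assumes "finite W" "card W \<le> N"
  shows "card (centers W n) \<le> 3 * N ^ n"
proof (induction n)
  case 0
  then show ?case by (simp add: card_cartesian_product)
next
  case (Suc n)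
  let ?P = "{(w, y) \<in> W \<times> centers W n. fst w = fst y}"
  have fin: "finite (W \<times> centers W n)" using assms by (simp add: finite_centers)
  have sub: "?P \<subseteq> W \<times> centers W n" by auto
  have "card (centers W (Suc n)) \<le> card ?P"
    unfolding centers.simps by (rule card_image_le[OF finite_subset[OF sub fin]])
  also have "\<dots> \<le> card (W \<times> centers W n)"
    using sub fin by (rule card_mono[rotated])
  also have "\<dots> \<le> N * (3 * N ^ n)"
    using assms Suc by (simp add: card_cartesian_product mult_le_mono)
  finally show ?case by (simp add: ac_simps)
qed

section \<open>Words that occur for given decision points\<close>

context
  fixes D :: "3 \<Rightarrow> real"
begin

text \<open>In contrast to \<open>run\<close>, only admissible choices are followed: these are the
  end states of all admissible runs of the word, started anywhere on side \<open>i\<close>.\<close>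

fun cell :: "3 \<Rightarrow> bool list \<Rightarrow> real set" where
  "cell i [] = UNIV"
| "cell i (b # bs) = g (side i bs) b ` {u \<in> cell i bs. ok (D (side i bs)) b u}"

lemma connected_cell: "connected (cell i bs)"
proof (induction bs)
  case (Cons b bs)
  let ?e = "D (side i bs)"
  have "is_interval {u. ok ?e b u}"
    by (auto simp: is_interval_1 ok_def)
  then have "is_interval (cell i bs \<inter> {u. ok ?e b u})"
    using Cons by (intro is_interval_Int) (auto simp: is_interval_connected_1)
  then have "connected (cell i bs \<inter> {u. ok ?e b u})"
    by (simp add: is_interval_connected_1)
  then show ?case
    by (auto intro!: connected_continuous_image continuous_on_g simp: Collect_conj_eq)
qed simp

text \<open>A point determines the itinerary leading to it, because the dynamics is injective.\<close>
lemma cell_unique: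
  assumes D: "\<And>i. \<bar>D i\<bar> \<le> M"
    and "length bs = length bs'" "side i bs = side i' bs'"
    and "u \<in> cell i bs" "u \<in> cell i' bs'"
  shows "i = i' \<and> bs = bs'"
  using assms(2-)
proof (induction bs bs' arbitrary: u rule: list_induct2)
  case (Cons b bs b' bs')
  let ?s = "side i bs" and ?s' = "side i' bs'"
  obtain y where y: "y \<in> cell i bs" "ok (D ?s) b y" "u = g ?s b y"
    using Cons.prems by auto
  obtain y' where y': "y' \<in> cell i' bs'" "ok (D ?s') b' y'" "u = g ?s' b' y'"
    using Cons.prems by auto
  have nx: "nx ?s b = nx ?s' b'" using Cons.prems by simp
  \<comment> \<open>Different choices leading to the same side would be the two branches that
    \<open>disj\<close> separates.\<close>
  have b: "b = b'"
  proof (rule ccontr)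
    assume "b \<noteq> b'"
    with nx y y' disj[of ?s ?s' y y'] disj[of ?s' ?s y' y] show False
      by (cases b) (auto simp: nx_def)
  qed
  with nx have s: "?s = ?s'" by (auto simp: nx_def split: if_splits)
  with b y y' inj[OF D, where i = ?s and b = b and u = y and v = y'] have "y = y'" by simp
  with Cons.IH s y y' b show ?case by blast
qed simp

definition realized :: "nat \<Rightarrow> (3 \<times> bool list) set" where
  "realized k = {(i, bs). length bs = k \<and> cell i bs \<noteq> {}}"

lemma realized_words: "realized k \<subseteq> {(i, bs). length bs = k}"
  by (auto simp: realized_def)

lemma finite_realized: "finite (realized k)"
  using realized_words finite_words by (rule finite_subset)

text \<open>Cells are intervals, so both extensions of a word are realized only if its cell contains
  the decision point of its side. Cells of the same length on the same side are disjoint,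
  so this happens for at most one word per side.\<close>
lemma card_realized:
  assumes D: "\<And>i. \<bar>D i\<bar> \<le> M"
  shows "card (realized k) \<le> 3 * (k + 1)"
proof (induction k)
  case 0
  have "realized 0 = UNIV \<times> {[]}" by (auto simp: realized_def)
  then show ?case by (simp add: card_cartesian_product)
next
  case (Suc k)
  define B where "B = {(i, bs). (i, bs) \<in> realized k \<and> D (side i bs) \<in> cell i bs}"
  \<comment> \<open>\<open>ch\<close> extends a word by \<open>True\<close> if that extension is
    realized and by \<open>False\<close> otherwise; \<open>opp\<close> supplies the second extension
    where both are realized.\<close>
  define ch where "ch w = (case w of (i, bs) \<Rightarrow> (i, (cell i (True # bs) \<noteq> {}) # bs))" for w
  define opp where "opp w = (case w of (i, bs) \<Rightarrow> (i, False # bs))" for w :: "3 \<times> bool list"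
  have "inj_on (\<lambda>(i, bs). side i bs) B"
  proof (rule inj_onI)
    fix w w' assume w: "w \<in> B" "w' \<in> B" "(\<lambda>(i, bs). side i bs) w = (\<lambda>(i, bs). side i bs) w'"
    obtain i bs i' bs' where "w = (i, bs)" "w' = (i', bs')" by fastforce
    with w show "w = w'"
      using cell_unique[OF D, of bs bs' i i' "D (side i bs)"] by (simp add: B_def realized_def)
  qed
  then have "card B \<le> card (UNIV :: 3 set)"
    by (rule card_inj_on_le) auto
  then have cB: "card B \<le> 3" by simp
  have fB: "finite B"
    by (rule finite_subset[OF _ finite_realized[of k]]) (auto simp: B_def)
  have "realized (Suc k) \<subseteq> ch ` realized k \<union> opp ` B"
  proof
    fix w assume w: "w \<in> realized (Suc k)"
    then obtain i b bs where wb: "w = (i, b # bs)" "length bs = k" "cell i (b # bs) \<noteq> {}"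
      unfolding realized_def by (auto simp del: cell.simps simp: length_Suc_conv)
    then have r: "(i, bs) \<in> realized k" by (auto simp: realized_def)
    show "w \<in> ch ` realized k \<union> opp ` B"
    proof (cases "b = (cell i (True # bs) \<noteq> {})")
      case True
      then have "w = ch (i, bs)" by (simp add: wb ch_def)
      with r show ?thesis by blast
    next
      case False
      with wb have b: "\<not> b" "cell i (True # bs) \<noteq> {}" by (cases b; simp)+
      then obtain u where u: "u \<in> cell i bs" "D (side i bs) \<le> u" by (auto simp: ok_def)
      from b wb obtain v where v: "v \<in> cell i bs" "v \<le> D (side i bs)" by (auto simp: ok_def)
      have "D (side i bs) \<in> cell i bs"
        using connected_cell[of i bs] u v by (meson connected_contains_Icc atLeastAtMost_iff subsetD)
      with r have "(i, bs) \<in> B" by (auto simp: B_def)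
      moreover have "w = opp (i, bs)" using b wb by (simp add: opp_def)
      ultimately show ?thesis by blast
    qed
  qed
  then have "card (realized (Suc k)) \<le> card (ch ` realized k \<union> opp ` B)"
    by (intro card_mono) (auto intro: finite_realized fB)
  also have "\<dots> \<le> card (ch ` realized k) + card (opp ` B)" by (rule card_Un_le)
  also have "\<dots> \<le> card (realized k) + card B"
    by (intro add_mono card_image_le finite_realized fB)
  finally show ?case using Suc cB by simp
qed

section \<open>Orbits and the intervals that cover them\<close>

definition step :: "3 \<times> real \<Rightarrow> 3 \<times> real \<Rightarrow> bool" where
  "step s s' \<longleftrightarrow> (\<exists>b. ok (D (fst s)) b (snd s) \<and> s' = (nx (fst s) b, g (fst s) b (snd s)))"

definition orbit :: "(nat \<Rightarrow> 3 \<times> real) \<Rightarrow> bool" where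
  "orbit s \<longleftrightarrow> (\<forall>t. step (s t) (s (Suc t)))"

definition periodic :: "(nat \<Rightarrow> 3 \<times> real) \<Rightarrow> bool" where
  "periodic s \<longleftrightarrow> orbit s \<and> (\<exists>p>0. \<forall>t. s (t + p) = s t)"

text \<open>The same \<open>\<epsilon>\<close> and \<open>m\<close> must serve all orbits, because
  periodic orbits are later compared with one another on a grid of mesh
  \<open>\<epsilon>\<close>.\<close>

definition separated :: "real \<Rightarrow> nat \<Rightarrow> bool" where
  "separated \<epsilon> m \<longleftrightarrow> (\<forall>s t. orbit s \<longrightarrow> m \<le> t \<longrightarrow> \<epsilon> \<le> \<bar>snd (s t) - D (fst (s t))\<bar>)"

lemma orbit_shift: "orbit s \<Longrightarrow> orbit (\<lambda>t. s (t + r))"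
  by (simp add: orbit_def)

lemma orbit_word:
  assumes "orbit s"
  obtains bs where "(fst (s 0), bs) \<in> realized k"
    "s k = (side (fst (s 0)) bs, run (fst (s 0)) bs (snd (s 0)))"
proof -
  have "\<exists>bs. length bs = k \<and> fst (s k) = side (fst (s 0)) bs \<and>
      snd (s k) = run (fst (s 0)) bs (snd (s 0)) \<and> snd (s k) \<in> cell (fst (s 0)) bs"
  proof (induction k)
    case (Suc k)
    then obtain bs where bs: "length bs = k" "fst (s k) = side (fst (s 0)) bs"
      "snd (s k) = run (fst (s 0)) bs (snd (s 0))" "snd (s k) \<in> cell (fst (s 0)) bs"
      by blast
    from assms obtain b where b: "ok (D (fst (s k))) b (snd (s k))"
      "s (Suc k) = (nx (fst (s k)) b, g (fst (s k)) b (snd (s k)))"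
      by (auto simp: orbit_def step_def)
    show ?case
      by (rule exI[of _ "b # bs"]) (use b bs in auto)
  qed simp
  then show ?thesis
    by (auto simp: realized_def prod_eq_iff intro!: that)
qed

lemma orbit_bound: "orbit s \<Longrightarrow> \<bar>snd (s (Suc t))\<bar> \<le> L"
  using bound by (auto simp: orbit_def step_def dest!: spec[of _ t])


text \<open>A state in \<open>[-L, L]\<close> is within \<open>L\<close> of the center 0. Each block
  of \<open>k\<close> steps follows a realized word, and running this word on the old center
  multiplies the error by at most \<open>c ^ k\<close>.\<close>

lemma orbit_cover:
  assumes "orbit s" "\<bar>snd (s 0)\<bar> \<le> L"
  shows "\<exists>x. (fst (s (k * n)), x) \<in> centers (realized k) n \<and>
    \<bar>snd (s (k * n)) - x\<bar> \<le> c ^ (k * n) * L"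
proof (induction n)
  case 0
  then show ?case using assms by auto
next
  case (Suc n)
  let ?s = "\<lambda>t. s (t + k * n)"
  let ?i = "fst (s (k * n))"
  obtain x where x: "(?i, x) \<in> centers (realized k) n" "\<bar>snd (s (k * n)) - x\<bar> \<le> c ^ (k * n) * L"
    using Suc by blast
  obtain bs where bs: "(?i, bs) \<in> realized k"
    "s (k + k * n) = (side ?i bs, run ?i bs (snd (s (k * n))))"
    using orbit_word[OF orbit_shift[OF assms(1), of "k * n"], of k] by auto
  have "(side ?i bs, run ?i bs x) \<in> centers (realized k) (Suc n)"
    using bs(1) x(1) by (auto intro!: image_eqI[of _ _ "((?i, bs), (?i, x))"])
  moreover have "\<bar>run ?i bs (snd (s (k * n))) - run ?i bs x\<bar> \<le> c ^ k * \<bar>snd (s (k * n)) - x\<bar>"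
    using run_lip[of ?i bs] bs(1) by (simp add: realized_def)
  moreover have "c ^ k * \<bar>snd (s (k * n)) - x\<bar> \<le> c ^ k * (c ^ (k * n) * L)"
    using x(2) c by (intro mult_left_mono) auto
  ultimately show ?case
    using bs(2) by (intro exI[of _ "run ?i bs x"]) (auto simp: power_add mult.assoc)
qed

text \<open>There are finitely many centers, so the strict inequalities leave a positive minimal
  clearance.\<close>

lemma orbit_gap:
  assumes "\<And>i x. (i, x) \<in> centers (realized k) n \<Longrightarrow> c ^ (k * n) * L < \<bar>D i - x\<bar>"
  obtains \<epsilon> where "0 < \<epsilon>" "separated \<epsilon> (Suc (k * n))"
proof
  let ?r = "c ^ (k * n) * L" and ?C = "centers (realized k) n"
  \<comment> \<open>The element 1 keeps the set nonempty, so that its minimum is meaningful.\<close>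
  let ?E = "insert 1 ((\<lambda>(i, x). \<bar>D i - x\<bar> - ?r) ` ?C)"
  have fin: "finite ?E" by (simp add: finite_centers finite_realized)
  then show "0 < Min ?E" using assms by (auto simp: Min_gr_iff)
  have "Min ?E \<le> \<bar>snd (s t) - D (fst (s t))\<bar>" if s: "orbit s" "Suc (k * n) \<le> t" for s t
  proof -
    \<comment> \<open>Going back \<open>k * n\<close> steps from \<open>t\<close> leads to the
      positive time \<open>Suc r\<close>; the state there is the value of a branch and hence bounded
      by \<open>L\<close>.\<close>
    define r where "r = t - k * n - 1"
    have t: "k * n + Suc r = t" using s(2) by (simp add: r_def)
    obtain x where x: "(fst (s t), x) \<in> ?C" "\<bar>snd (s t) - x\<bar> \<le> ?r"
      using orbit_cover[OF orbit_shift[OF s(1), of "Suc r"]] orbit_bound[OF s(1)] t by force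
    have "Min ?E \<le> \<bar>D (fst (s t)) - x\<bar> - ?r"
      using fin x(1) by (intro Min_le) auto
    then show ?thesis using x(2) by linarith
  qed
  then show "separated (Min ?E) (Suc (k * n))" by (simp add: separated_def)
qed

section \<open>Orbits that stay away from the decision points\<close>

context
  fixes \<epsilon> :: real and m :: nat
  assumes \<epsilon>: "0 < \<epsilon>"
    and sep: "separated \<epsilon> m"
begin

lemma gap: "orbit s \<Longrightarrow> m \<le> t \<Longrightarrow> \<epsilon> \<le> \<bar>snd (s t) - D (fst (s t))\<bar>"
  using sep by (simp add: separated_def)

definition grid :: "3 \<times> real \<Rightarrow> 3 \<times> int" where
  "grid s = (fst s, \<lfloor>snd s / \<epsilon>\<rfloor>)"

lemma grid_close:
  assumes "grid s = grid s'"
  shows "fst s = fst s'" "\<bar>snd s - snd s'\<bar> < \<epsilon>"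
proof -
  show "fst s = fst s'" using assms by (simp add: grid_def)
  have "\<bar>snd s / \<epsilon> - snd s' / \<epsilon>\<bar> < 1"
    using assms unfolding grid_def by (simp, linarith)
  then show "\<bar>snd s - snd s'\<bar> < \<epsilon>"
    using \<epsilon> by (simp add: diff_divide_distrib[symmetric])
qed

lemma finite_grid: "finite (grid ` {s. \<bar>snd s\<bar> \<le> L})"
proof (rule finite_subset)
  show "grid ` {s. \<bar>snd s\<bar> \<le> L} \<subseteq> UNIV \<times> {\<lfloor>- L / \<epsilon>\<rfloor>..\<lfloor>L / \<epsilon>\<rfloor>}"
    using \<epsilon> by (auto simp: grid_def abs_le_iff divide_right_mono minus_divide_left
        simp del: divide_minus_left intro!: floor_mono)
qed auto

text \<open>Different choices would put the two states on opposite sides of the decision point, each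
  at distance at least \<open>\<epsilon>\<close> from it, hence \<open>2 * \<epsilon>\<close> apart.
  So the choices agree, and the common branch contracts the distance.\<close>

lemma same_itinerary:
  assumes "orbit s" "orbit s'" "m \<le> r" "m \<le> r'"
    and "fst (s r) = fst (s' r')" "\<bar>snd (s r) - snd (s' r')\<bar> < \<epsilon>"
  shows "fst (s (r + t)) = fst (s' (r' + t)) \<and>
    \<bar>snd (s (r + t)) - snd (s' (r' + t))\<bar> \<le> c ^ t * \<epsilon>"
proof (induction t)
  case 0
  then show ?case using assms by simp
next
  case (Suc t)
  let ?i = "fst (s (r + t))" and ?u = "snd (s (r + t))" and ?u' = "snd (s' (r' + t))"
  have i: "fst (s' (r' + t)) = ?i" using Suc by simp
  obtain b where b: "ok (D ?i) b ?u" "s (Suc (r + t)) = (nx ?i b, g ?i b ?u)"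
    using assms(1) by (auto simp: orbit_def step_def)
  obtain b' where b': "ok (D ?i) b' ?u'" "s' (Suc (r' + t)) = (nx ?i b', g ?i b' ?u')"
    using assms(2) i unfolding orbit_def step_def by metis
  have "c ^ t * \<epsilon> \<le> 1 * \<epsilon>"
    using c \<epsilon> by (intro mult_right_mono power_le_one) auto
  with Suc have "\<bar>?u - ?u'\<bar> \<le> \<epsilon>" by simp
  with gap[OF assms(1), of "r + t"] gap[OF assms(2), of "r' + t"] b(1) b'(1) assms(3,4) \<epsilon> i
  have "b = b'" by (auto simp: ok_def split: if_splits)
  moreover have "\<bar>g ?i b ?u - g ?i b ?u'\<bar> \<le> c * (c ^ t * \<epsilon>)"
    using lip[of ?i b ?u ?u'] Suc c by (meson less_imp_le mult_left_mono order_trans)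
  ultimately show ?case using b(2) b'(2) by simp
qed

text \<open>By the pigeonhole principle the orbit returns to a grid cell after some \<open>p\<close>
  steps. From then on it and its shift by \<open>p\<close> share their itinerary and approach each
  other geometrically, so the states converge along each residue class modulo \<open>p\<close>. The
  limits form the periodic orbit \<open>v\<close>.\<close>

lemma orbit_converges:
  assumes s: "orbit s"
  obtains r p v where "0 < p" "orbit v" "\<And>n. v (n + p) = v n"
    "\<And>n t. fst (s (r + n + p * t)) = fst (v n)"
    "\<And>n. (\<lambda>t. snd (s (r + n + p * t))) \<longlonglongrightarrow> snd (v n)"
proof -
  \<comment> \<open>The delay \<open>Suc m\<close> is at least \<open>m\<close>, as separation
    requires, and positive, which gives the bound \<open>L\<close>.\<close>
  have "\<not> inj (\<lambda>t. grid (s (t + Suc m)))"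
  proof
    assume "inj (\<lambda>t. grid (s (t + Suc m)))"
    moreover have "range (\<lambda>t. grid (s (t + Suc m))) \<subseteq> grid ` {s. \<bar>snd s\<bar> \<le> L}"
      using orbit_bound[OF s] by auto
    ultimately show False
      using range_inj_infinite finite_subset[OF _ finite_grid] by blast
  qed
  then obtain t1 t2 where "t1 \<noteq> t2" "grid (s (t1 + Suc m)) = grid (s (t2 + Suc m))"
    unfolding inj_def by blast
  then obtain t1 t2 where t12: "t1 < t2" "grid (s (t1 + Suc m)) = grid (s (t2 + Suc m))"
    by (metis linorder_neqE_nat)
  define r p where "r = t1 + Suc m" and "p = t2 - t1"
  have p: "0 < p" and rp: "r + p = t2 + Suc m" using t12 by (auto simp: r_def p_def)
  have per: "fst (s (r + n)) = fst (s (r + p + n)) \<and>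
      \<bar>snd (s (r + n)) - snd (s (r + p + n))\<bar> \<le> c ^ n * \<epsilon>" for n
  proof (rule same_itinerary[OF s s])
    show "m \<le> r" "m \<le> r + p" by (simp_all add: r_def)
    show "fst (s r) = fst (s (r + p))" "\<bar>snd (s r) - snd (s (r + p))\<bar> < \<epsilon>"
      using grid_close[OF t12(2)] by (simp_all only: r_def rp[unfolded r_def])
  qed
  have fst_per: "fst (s (r + n + p * t)) = fst (s (r + n))" for n t
  proof (induction t)
    case (Suc t)
    moreover have "r + (n + p * t) = r + n + p * t" "r + p + (n + p * t) = r + n + p * Suc t"
      by simp_all
    ultimately show ?case using per[of "n + p * t"] by metis
  qed simp
  have conv: "convergent (\<lambda>t. snd (s (r + n + p * t)))" for n
  proof -
    define x where "x t = snd (s (r + n + p * t))" for t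
    have le: "norm (x (Suc t) - x t) \<le> \<epsilon> * c ^ t" for t
    proof -
      have "r + (n + p * t) = r + n + p * t" "r + p + (n + p * t) = r + n + p * Suc t"
        by simp_all
      then have "\<bar>x (Suc t) - x t\<bar> \<le> c ^ (n + p * t) * \<epsilon>"
        using per[of "n + p * t"] unfolding x_def by (simp only: abs_minus_commute)
      also have "\<dots> \<le> c ^ t * \<epsilon>"
        using c \<epsilon> p by (intro mult_right_mono power_decreasing) (auto simp: trans_le_add2)
      finally show ?thesis by (simp add: mult.commute)
    qed
    have "summable (\<lambda>t. \<epsilon> * c ^ t)"
      using c by (intro summable_mult summable_geometric) auto
    then have "summable (\<lambda>t. x (Suc t) - x t)"
      by (rule summable_comparison_test'[where N = 0]) (rule le)
    then have "convergent (\<lambda>t. \<Sum>i<t. x (Suc i) - x i)"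
      by (simp add: summable_iff_convergent)
    then have "convergent (\<lambda>t. x t - x 0)" by (simp add: sum_lessThan_telescope)
    then have "convergent (\<lambda>t. (x t - x 0) + x 0)" by (rule convergent_add[OF _ convergent_const])
    then show ?thesis by (simp add: x_def)
  qed
  define l where "l n = lim (\<lambda>t. snd (s (r + n + p * t)))" for n
  have l: "(\<lambda>t. snd (s (r + n + p * t))) \<longlonglongrightarrow> l n" for n
    using conv[of n] by (simp add: l_def convergent_LIMSEQ_iff)
  define v where "v n = (fst (s (r + n)), l n)" for n
  have "step (v n) (v (Suc n))" for n
  proof -
    let ?i = "fst (s (r + n))"
    have "\<exists>b. ok (D ?i) b (snd (s (r + n + p * t))) \<and>
      s (r + Suc n + p * t) = (nx ?i b, g ?i b (snd (s (r + n + p * t))))" for t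
      using s fst_per[of n t] unfolding orbit_def step_def by (metis add_Suc add_Suc_right)
    then obtain b where b: "\<And>t. ok (D ?i) (b t) (snd (s (r + n + p * t)))"
      "\<And>t. s (r + Suc n + p * t) = (nx ?i (b t), g ?i (b t) (snd (s (r + n + p * t))))"
      by metis
    \<comment> \<open>The next side reveals the choice, and it is the same for all
      \<open>t\<close>.\<close>
    have "b t = b 0" for t
      using fst_per[of "Suc n" t] b(2)[of t] b(2)[of 0] by simp
    then obtain b0 where bc: "\<And>t. b t = b0" by blast
    have "ok (D ?i) b0 (l n)"
      using b(1) LIMSEQ_le_const[OF l] LIMSEQ_le_const2[OF l] by (auto simp: ok_def bc)
    moreover have "isCont (g ?i b0) (l n)"
      using continuous_on_g[of UNIV] by (simp add: continuous_on_eq_continuous_at)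
    then have "(\<lambda>t. g ?i b0 (snd (s (r + n + p * t)))) \<longlonglongrightarrow> g ?i b0 (l n)"
      by (rule isCont_tendsto_compose) (rule l)
    then have "(\<lambda>t. snd (s (r + Suc n + p * t))) \<longlonglongrightarrow> g ?i b0 (l n)"
      using b(2) by (simp add: bc)
    then have "l (Suc n) = g ?i b0 (l n)"
      using l LIMSEQ_unique by blast
    moreover have "fst (s (r + Suc n)) = nx ?i b0"
      using b(2)[of 0] by (simp add: bc)
    ultimately show ?thesis by (auto simp: v_def step_def)
  qed
  then have "orbit v" by (simp add: orbit_def)
  moreover have "v (n + p) = v n" for n
  proof -
    \<comment> \<open>The subsequence belonging to \<open>n + p\<close> is the one belonging to
      \<open>n\<close>, shifted by one index.\<close>
    have "(\<lambda>t. snd (s (r + n + p * Suc t))) \<longlonglongrightarrow> l n" by (rule LIMSEQ_Suc) (rule l)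
    then have "(\<lambda>t. snd (s (r + (n + p) + p * t))) \<longlonglongrightarrow> l n" by (simp add: ac_simps)
    then have "l (n + p) = l n" using l LIMSEQ_unique by blast
    then show ?thesis using fst_per[of n 1] by (simp add: v_def ac_simps)
  qed
  ultimately show ?thesis
    using that[of p v r] p fst_per l by (simp add: v_def)
qed

text \<open>Separation is known only from time \<open>m\<close> on, but after \<open>m\<close>
  common periods \<open>q\<close> both orbits are back at their initial states, where
  \<open>same_itinerary\<close> applies. Waiting \<open>j\<close> more periods bounds their distance
  at time \<open>t\<close> by \<open>c ^ j * \<epsilon>\<close>, for every \<open>j\<close>.\<close>

lemma periodic_eq:
  assumes "periodic s" "periodic s'" "grid (s 0) = grid (s' 0)"
  shows "s = s'"
proof
  fix t
  obtain p p' where p: "orbit s" "orbit s'" "0 < p" "0 < p'"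
    "\<And>t. s (t + p) = s t" "\<And>t. s' (t + p') = s' t"
    using assms unfolding periodic_def by blast
  have mult: "s (t + j * p) = s t" "s' (t + j * p') = s' t" for t j
  proof (induction j)
    case (Suc j)
    have "t + Suc j * p = (t + j * p) + p" "t + Suc j * p' = (t + j * p') + p'" by simp_all
    then show "s (t + Suc j * p) = s t" "s' (t + Suc j * p') = s' t"
      using Suc p(5,6) by presburger+
  qed simp_all
  define q where "q = p * p'"
  have q: "0 < q" using p by (simp add: q_def)
  have mq: "s (t + j * q) = s t" "s' (t + j * q) = s' t" for t j
    using mult(1)[of t "j * p'"] mult(2)[of t "j * p"]
    by (simp_all only: q_def mult.assoc mult.commute[of p p'])
  have close: "fst (s t) = fst (s' t) \<and> \<bar>snd (s t) - snd (s' t)\<bar> \<le> c ^ j * \<epsilon>" for j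
  proof -
    have "fst (s (m * q + (t + j * q))) = fst (s' (m * q + (t + j * q))) \<and>
      \<bar>snd (s (m * q + (t + j * q))) - snd (s' (m * q + (t + j * q)))\<bar> \<le> c ^ (t + j * q) * \<epsilon>"
      using grid_close[OF assms(3)] mq[of 0 m] q
      by - (rule same_itinerary[OF p(1,2)], auto)
    moreover have "c ^ (t + j * q) * \<epsilon> \<le> c ^ j * \<epsilon>"
      using c \<epsilon> q by (intro mult_right_mono power_decreasing) (auto simp: trans_le_add2)
    moreover have "s (m * q + (t + j * q)) = s t" "s' (m * q + (t + j * q)) = s' t"
      using mq[of t "m + j"] by (simp_all add: algebra_simps)
    ultimately show ?thesis by auto
  qed
  have "(\<lambda>j. c ^ j * \<epsilon>) \<longlonglongrightarrow> 0"
    using c by (intro tendsto_mult_left_zero LIMSEQ_power_zero) auto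
  then have "\<bar>snd (s t) - snd (s' t)\<bar> \<le> 0"
    using close by (intro LIMSEQ_le_const[of _ 0]) auto
  with close show "s t = s' t" by (simp add: prod_eq_iff)
qed

text \<open>The initial state of a periodic orbit is also a later one, so it is bounded by
  \<open>L\<close>; its grid cell determines the orbit.\<close>

lemma finite_periodic: "finite {s. periodic s}"
proof (rule finite_imageD)
  show "inj_on (\<lambda>s. grid (s 0)) {s. periodic s}"
    by (rule inj_onI) (simp add: periodic_eq)
  have "\<bar>snd (s 0)\<bar> \<le> L" if s: "periodic s" for s
  proof -
    obtain p where p: "orbit s" "0 < p" "\<forall>t. s (t + p) = s t"
      using s unfolding periodic_def by blast
    then have "s p = s 0" by (metis add_0)
    then show ?thesis using orbit_bound[OF p(1), of "p - 1"] p(2) by simp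
  qed
  then show "finite ((\<lambda>s. grid (s 0)) ` {s. periodic s})"
    by - (rule finite_subset[OF _ finite_grid], auto)
qed

end

end

end

section \<open>Generic decision points\<close>

definition sigm :: "real \<Rightarrow> real" where
  "sigm u = 1 / (1 + exp u)"

text \<open>On \<open>(0,1)\<close> this inverts \<open>sigm\<close>. Both functions are decreasing,
  so \<open>x \<le> d\<close> turns into a lower bound on the coordinate.\<close>

definition logodds :: "real \<Rightarrow> real" where
  "logodds x = ln ((1 - x) / x)"

lemma sigm_bounds: "0 < sigm u" "sigm u < 1"
  by (simp_all add: sigm_def add_pos_pos)

lemma sigm_logodds: "0 < x \<Longrightarrow> x < 1 \<Longrightarrow> sigm (logodds x) = x"
  by (simp add: sigm_def logodds_def field_simps)

lemma sigm_le_iff: "sigm u \<le> sigm v \<longleftrightarrow> v \<le> u"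
proof -
  have "0 < 1 + exp u" "0 < 1 + exp v" by (simp_all add: add_pos_pos)
  then show ?thesis by (simp add: sigm_def field_simps)
qed

lemma sigm_inject: "sigm u = sigm v \<longleftrightarrow> u = v"
  by (metis order_antisym order_refl sigm_le_iff)

lemma isCont_sigm: "isCont sigm u"
proof -
  have "1 + exp u \<noteq> 0" by (simp add: add_pos_pos less_imp_neq[THEN not_sym])
  then show ?thesis unfolding sigm_def[abs_def] by (intro continuous_intros)
qed

text \<open>This carries intervals in the log-odds over to intervals of the decision points without
  enlarging the radius. The numerator \<open>exp v - exp u\<close> is at most
  \<open>exp v * (v - u)\<close>, and the denominator is at least \<open>exp v\<close>.\<close>

lemma sigm_lip: "\<bar>sigm u - sigm v\<bar> \<le> \<bar>u - v\<bar>"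
proof -
  have *: "sigm u - sigm v \<le> v - u" if "u \<le> v" for u v
  proof -
    have p: "0 < 1 + exp u" "0 < 1 + exp v" by (simp_all add: add_pos_pos)
    have "1 - (v - u) \<le> exp (- (v - u))" using exp_ge_add_one_self[of "- (v - u)"] by linarith
    then have "exp v * (1 - (v - u)) \<le> exp v * exp (- (v - u))" by (rule mult_left_mono) simp
    then have e: "exp v - exp u \<le> exp v * (v - u)"
      by (simp add: exp_add[symmetric] algebra_simps)
    have "sigm u - sigm v = (exp v - exp u) / ((1 + exp u) * (1 + exp v))"
      using p by (simp add: sigm_def field_simps)
    also have "\<dots> \<le> exp v * (v - u) / ((1 + exp u) * (1 + exp v))"
      using p e by (intro divide_right_mono) auto
    also have "\<dots> = (v - u) * (exp v / ((1 + exp u) * (1 + exp v)))" by simp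
    also have "\<dots> \<le> (v - u) * 1"
    proof (rule mult_left_mono)
      have "1 * (1 + exp v) \<le> (1 + exp u) * (1 + exp v)"
        using p by (intro mult_right_mono) auto
      then have "exp v \<le> (1 + exp u) * (1 + exp v)" by simp
      then show "exp v / ((1 + exp u) * (1 + exp v)) \<le> 1" using p by (simp add: divide_le_eq)
    qed (use that in simp)
    finally show ?thesis by simp
  qed
  show ?thesis
  proof (cases "u \<le> v")
    case True
    with *[of u v] sigm_le_iff[of v u] show ?thesis by simp
  next
    case False
    with *[of v u] sigm_le_iff[of u v] show ?thesis by simp
  qed
qed

text \<open>Within the unit cube, the points whose coordinate \<open>i\<close> is within
  \<open>r\<close> of \<open>a\<close> fit into a box with one edge \<open>2 * r\<close> and the
  others 1.\<close>

lemma negligible_slabs: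
  fixes S :: "(real ^ 'n) set"
  assumes "S \<subseteq> box 0 1"
    and cover: "\<And>e. 0 < e \<Longrightarrow> \<exists>C (r :: real). finite C \<and> 0 \<le> r \<and> card C * (2 * r) < e \<and>
      S \<subseteq> {d. \<exists>(i, a)\<in>C. \<bar>d $ i - a\<bar> \<le> r}"
  shows "negligible S"
  unfolding negligible_outer
proof (intro allI impI)
  fix e :: real assume "0 < e"
  then obtain C and r :: real where C: "finite C" "0 \<le> r" "card C * (2 * r) < e"
    "S \<subseteq> {d. \<exists>(i, a)\<in>C. \<bar>d $ i - a\<bar> \<le> r}"
    using cover by blast
  define slab :: "'n \<times> real \<Rightarrow> (real ^ 'n) set" where
    "slab w = cbox (\<chi> l. if l = fst w then snd w - r else 0) (\<chi> l. if l = fst w then snd w + r else 1)" for w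
  have slab: "measure lebesgue (slab w) = 2 * r" for w
  proof -
    have ne: "slab w \<noteq> {}" unfolding slab_def interval_ne_empty_cart using C by auto
    have "measure lebesgue (slab w) =
        (\<Prod>l\<in>UNIV. (if l = fst w then snd w + r else 1) - (if l = fst w then snd w - r else 0))"
      using content_cbox_cart[OF ne[unfolded slab_def]]
      by (simp add: slab_def measure_completion)
    also have "\<dots> = (\<Prod>l\<in>UNIV. if l = fst w then 2 * r else 1)"
      by (intro prod.cong) auto
    finally show ?thesis by simp
  qed
  have "S \<subseteq> (\<Union>w\<in>C. slab w)"
  proof
    fix d assume d: "d \<in> S"
    then obtain i a where ia: "(i, a) \<in> C" "\<bar>d $ i - a\<bar> \<le> r" using C by auto
    have "d \<in> box 0 1" using d assms by auto
    then have "d \<in> slab (i, a)" using ia by (auto simp: slab_def mem_box_cart less_imp_le abs_le_iff)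
    with ia show "d \<in> (\<Union>w\<in>C. slab w)" by blast
  qed
  moreover have "(\<Union>w\<in>C. slab w) \<in> lmeasurable"
    using C by (intro fmeasurable.finite_UN) (auto simp: slab_def)
  moreover have "measure lebesgue (\<Union>w\<in>C. slab w) \<le> (\<Sum>w\<in>C. measure lebesgue (slab w))"
    using C by (intro measure_UNION_le) (auto simp: slab_def)
  then have "measure lebesgue (\<Union>w\<in>C. slab w) < e"
    using C(3) by (simp add: slab)
  ultimately show "\<exists>T. S \<subseteq> T \<and> T \<in> lmeasurable \<and> measure lebesgue T < e" by blast
qed

section \<open>The null set of exceptional decision points\<close>

context contracting_branches
begin

text \<open>At level \<open>n\<close> there are at most \<open>3 * N ^ n\<close> slabs of thickness
  \<open>2 * c ^ (k * n) * L\<close>, with total volume at most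
  \<open>6 * L * (N * c ^ k) ^ n\<close>, which tends to 0.\<close>

lemma negligible_bad:
  assumes W: "finite W" "card W \<le> N" and Nc: "real N * c ^ k < 1"
  shows "negligible {d \<in> box 0 1. \<forall>n. \<exists>i x. (i, x) \<in> centers W n \<and>
    \<bar>logodds (d $ i) - x\<bar> \<le> c ^ (k * n) * L}"
    (is "negligible ?S")
proof (rule negligible_slabs)
  fix e :: real assume e: "0 < e"
  have "(\<lambda>n. 6 * L * (N * c ^ k) ^ n) \<longlonglongrightarrow> 6 * L * 0"
    using Nc c by (intro tendsto_mult tendsto_const LIMSEQ_power_zero) auto
  then have "\<forall>\<^sub>F n in sequentially. 6 * L * (N * c ^ k) ^ n < e"
    using e by (simp add: order_tendsto_iff)
  then obtain n where n: "6 * L * (N * c ^ k) ^ n < e"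
    by (auto simp: eventually_sequentially)
  let ?C = "(\<lambda>(i, x). (i, sigm x)) ` centers W n" and ?r = "c ^ (k * n) * L"
  have r: "0 \<le> ?r" using c L_nonneg by simp
  have "card ?C \<le> card (centers W n)"
    using finite_centers[OF W(1)] by (rule card_image_le)
  also have "\<dots> \<le> 3 * N ^ n" using W by (rule card_centers)
  finally have "real (card ?C) \<le> real (3 * N ^ n)" by (rule of_nat_mono)
  then have "card ?C * (2 * ?r) \<le> real (3 * N ^ n) * (2 * ?r)"
    using r by (intro mult_right_mono) auto
  also have "\<dots> = 6 * L * (N * c ^ k) ^ n"
    by (simp add: power_mult power_mult_distrib)
  also note n
  finally have "card ?C * (2 * ?r) < e" .
  moreover have "?S \<subseteq> {d. \<exists>(i, a)\<in>?C. \<bar>d $ i - a\<bar> \<le> ?r}"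
  proof
    fix d assume d: "d \<in> ?S"
    then obtain i x where x: "(i, x) \<in> centers W n" "\<bar>logodds (d $ i) - x\<bar> \<le> ?r" by blast
    have "0 < d $ i" "d $ i < 1" using d by (auto simp: mem_box_cart)
    then have "\<bar>d $ i - sigm x\<bar> \<le> ?r"
      using sigm_lip[of "logodds (d $ i)" x] x(2) by (simp add: sigm_logodds)
    with x(1) show "d \<in> {d. \<exists>(i, a)\<in>?C. \<bar>d $ i - a\<bar> \<le> ?r}" by force
  qed
  ultimately show "\<exists>C (r :: real). finite C \<and> 0 \<le> r \<and> card C * (2 * r) < e \<and>
      ?S \<subseteq> {d. \<exists>(i, a)\<in>C. \<bar>d $ i - a\<bar> \<le> r}"
    using r finite_centers[OF W(1)] by (intro exI[of _ ?C] exI[of _ ?r]) simp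
qed auto

text \<open>The set \<open>realized k\<close> depends on the decision points, but it is one of
  finitely many candidates \<open>W\<close>; removing the null sets of all candidates removes the
  right one.\<close>

lemma gap_almost_everywhere:
  "\<exists>S :: (real ^ 3) set. negligible S \<and>
    (\<forall>d \<in> box 0 1 - S. (\<forall>i. \<bar>logodds (d $ i)\<bar> \<le> M) \<longrightarrow>
      (\<exists>\<epsilon> m. 0 < \<epsilon> \<and> separated (\<lambda>i. logodds (d $ i)) \<epsilon> m))"
proof -
  \<comment> \<open>The number of words grows linearly in \<open>k\<close> while
    \<open>c ^ k\<close> decays geometrically, so a suitable \<open>k\<close> exists.\<close>
  have "(\<lambda>k. 3 * (of_nat k * c ^ k) + 3 * c ^ k) \<longlonglongrightarrow> 3 * 0 + 3 * 0"
    using c by (intro tendsto_add tendsto_mult tendsto_const powser_times_n_limit_0 LIMSEQ_power_zero) auto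
  then have "\<forall>\<^sub>F k in sequentially. 3 * (of_nat k * c ^ k) + 3 * c ^ k < 1"
    by (simp add: order_tendsto_iff)
  then obtain k where "3 * (of_nat k * c ^ k) + 3 * c ^ k < 1"
    by (auto simp: eventually_sequentially)
  then have k: "real (3 * (k + 1)) * c ^ k < 1" by (simp add: algebra_simps)
  let ?words = "{(i :: 3, bs :: bool list). length bs = k}"
  define bad where "bad W = {d :: real ^ 3 \<in> box 0 1. \<forall>n. \<exists>i x. (i, x) \<in> centers W n \<and>
    \<bar>logodds (d $ i) - x\<bar> \<le> c ^ (k * n) * L}" for W
  define S where "S = \<Union> (bad ` {W \<in> Pow ?words. card W \<le> 3 * (k + 1)})"
  have "negligible S"
    unfolding S_def
  proof (rule negligible_Union)
    show "finite (bad ` {W \<in> Pow ?words. card W \<le> 3 * (k + 1)})"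
      using finite_words[of k] by simp
    fix T assume "T \<in> bad ` {W \<in> Pow ?words. card W \<le> 3 * (k + 1)}"
    then obtain W where W: "T = bad W" "W \<subseteq> ?words" "card W \<le> 3 * (k + 1)" by auto
    with finite_subset[OF W(2) finite_words] k show "negligible T"
      unfolding W(1) bad_def by (intro negligible_bad[where N = "3 * (k + 1)"])
  qed
  moreover have "\<exists>\<epsilon> m. 0 < \<epsilon> \<and> separated (\<lambda>i. logodds (d $ i)) \<epsilon> m"
    if d: "d \<in> box 0 1 - S" "\<forall>i. \<bar>logodds (d $ i)\<bar> \<le> M" for d
  proof -
    let ?D = "\<lambda>i. logodds (d $ i)"
    have D: "\<And>i. \<bar>?D i\<bar> \<le> M" using d by simp
    have "realized ?D k \<in> {W \<in> Pow ?words. card W \<le> 3 * (k + 1)}"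
      using card_realized[where D = ?D and k = k, OF D] realized_words by auto
    then have "d \<notin> bad (realized ?D k)" using d by (auto simp: S_def)
    then obtain n where n: "\<And>i x. (i, x) \<in> centers (realized ?D k) n \<Longrightarrow> c ^ (k * n) * L < \<bar>?D i - x\<bar>"
      using d by (auto simp: bad_def not_le)
    show ?thesis using orbit_gap[where D = ?D, OF n] by blast
  qed
  ultimately show ?thesis by blast
qed

end

section \<open>The triangle process in log-odds coordinates\<close>

definition log_affine :: "real \<Rightarrow> real \<Rightarrow> real \<Rightarrow> real" where
  "log_affine p q t = ln (p + q * exp t)"

lemma log_affine_inject:
  assumes "0 < p" "0 < q"
  shows "log_affine p q s = log_affine p q t \<longleftrightarrow> s = t"
proof -
  have "0 < p + q * exp s" "0 < p + q * exp t" using assms by (simp_all add: add_pos_pos)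
  with assms show ?thesis by (simp add: log_affine_def)
qed

lemma log_affine_gt: "0 < p \<Longrightarrow> 0 < q \<Longrightarrow> ln p < log_affine p q t"
  by (simp add: log_affine_def add_pos_pos)

lemma log_affine_bound:
  assumes "0 < p" "0 < q" "t \<le> M"
  shows "\<bar>log_affine p q t\<bar> \<le> \<bar>ln p\<bar> + \<bar>log_affine p q M\<bar>"
proof -
  have "log_affine p q t \<le> log_affine p q M"
    using assms by (simp add: log_affine_def add_pos_pos)
  with log_affine_gt[OF assms(1,2), of t] show ?thesis by linarith
qed

text \<open>The derivative \<open>q * exp t / (p + q * exp t)\<close> is below 1 but increases to 1
  as \<open>t\<close> grows. A uniform factor is available only below a bound \<open>M\<close>, and
  the derivative at \<open>M\<close> serves.\<close>

lemma log_affine_lip: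
  assumes pq: "0 < p" "0 < q" and "s \<le> M" "t \<le> M"
  shows "\<bar>log_affine p q s - log_affine p q t\<bar> \<le> q * exp M / (p + q * exp M) * \<bar>s - t\<bar>"
proof -
  have "norm (log_affine p q s - log_affine p q t) \<le> q * exp M / (p + q * exp M) * norm (s - t)"
  proof (rule field_differentiable_bound)
    show "convex {..M}" by simp
    fix z assume z: "z \<in> {..M}"
    have pos: "0 < p + q * exp z" "0 < p + q * exp M" using pq by (simp_all add: add_pos_pos)
    show "(log_affine p q has_field_derivative q * exp z / (p + q * exp z)) (at z within {..M})"
      unfolding log_affine_def[abs_def] using pos
      by (auto intro!: derivative_eq_intros simp: field_simps)
    have "p * (q * exp z) \<le> p * (q * exp M)" using z pq by simp
    then have "q * exp z / (p + q * exp z) \<le> q * exp M / (p + q * exp M)"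
      using pos by (simp add: divide_le_eq le_divide_eq field_simps)
    then show "norm (q * exp z / (p + q * exp z)) \<le> q * exp M / (p + q * exp M)"
      using pos pq by simp
  qed (use assms in auto)
  then show ?thesis by simp
qed

section \<open>Cyclic indices and points on the sides\<close>

lemma numeral_3_reduce: "(4 :: 3) = 1" "(5 :: 3) = 2"
  by simp_all

lemma forall_3_cyclic: "(\<forall>l :: 3. P l) \<longleftrightarrow> P i \<and> P (i + 1) \<and> P (i + 2)"
  using exhaust_3[of i] by (auto simp: forall_3 numeral_3_reduce)

lemma sum_3_cyclic:
  fixes v :: "real ^ 3"
  shows "v $ 1 + v $ 2 + v $ 3 = v $ i + v $ (i + 1) + v $ (i + 2)"
  using exhaust_3[of i] by (auto simp: numeral_3_reduce)

lemma shift_3: "(i :: 3) + 1 + 1 = i + 2" "i + 1 + 2 = i" "i + 2 + 1 = i" "i + 2 + 2 = i + 1"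
  using exhaust_3[of i] by auto

lemma shift_3_neq: "(i :: 3) \<noteq> i + 1" "i \<noteq> i + 2" "i + 1 \<noteq> i + 2" "i + 1 \<noteq> i" "i + 2 \<noteq> i" "i + 2 \<noteq> i + 1"
  using exhaust_3[of i] by auto

lemma sidept_nth: "sidept x i $ l = (if l = i + 1 then 1 - x else if l = i + 2 then x else 0)"
  using exhaust_3[of i] exhaust_3[of l] by (auto simp: sidept_def ebasis_def axis_def)

lemma cases_3_cyclic: "j = i \<or> j = i + 1 \<or> j = i + 2" for i j :: 3
  using forall_3_cyclic[of "\<lambda>l. j \<noteq> l" i] by blast

lemma sidept_values: "sidept x i $ i = 0" "sidept x i $ (i + 1) = 1 - x" "sidept x i $ (i + 2) = x"
  by (simp_all only: sidept_nth shift_3_neq if_True if_False simp_thms)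

text \<open>An interior point of a side has exactly one vanishing coordinate, which identifies the
  side; corners lie on two sides.\<close>

lemma sidept_inject:
  assumes "0 < x" "x < 1" "sidept x i = sidept y j"
  shows "x = y \<and> i = j"
proof -
  have "sidept x i $ j = 0" using assms(3) sidept_values(1) by simp
  then have ij: "j = i"
    using cases_3_cyclic[of j i] assms(1,2) sidept_values(2,3)[of x i] by auto
  with assms(3) sidept_values(3) show ?thesis by metis
qed

lemma sidept_in_A0i_iff:
  assumes "0 < x" "x < 1"
  shows "sidept x i \<in> A0i j \<longleftrightarrow> j = i"
proof
  assume "sidept x i \<in> A0i j"
  then have "sidept x i $ j = 0" by (simp add: A0i_def)
  then show "j = i"
    using cases_3_cyclic[of j i] assms sidept_values(2,3)[of x i] by auto
next
  assume "j = i"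
  then show "sidept x i \<in> A0i j"
    unfolding A0i_def mem_Collect_eq sum_3_cyclic[of _ i] forall_3_cyclic[of _ i] sidept_values
    using assms by (simp add: sidept_values)
qed

lemma rule_sidept:
  assumes "0 < x" "x < 1"
  shows "rule d (sidept x i) j \<longleftrightarrow> x \<le> d $ i \<and> j = i + 1 \<or> d $ i \<le> x \<and> j = i + 2"
    (is "_ \<longleftrightarrow> ?r")
proof
  assume "rule d (sidept x i) j"
  then obtain i' y where "sidept x i = sidept y i'"
    "y < d $ i' \<and> j = i' + 1 \<or> d $ i' < y \<and> j = i' + 2 \<or> y = d $ i' \<and> (j = i' + 1 \<or> j = i' + 2)"
    unfolding rule_def by blast
  moreover from this(1) have "x = y" "i = i'" using sidept_inject[OF assms] by blast+
  ultimately show ?r by auto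
next
  assume ?r
  then have "x < d $ i \<and> j = i + 1 \<or> d $ i < x \<and> j = i + 2 \<or> x = d $ i \<and> (j = i + 1 \<or> j = i + 2)"
    by linarith
  with assms show "rule d (sidept x i) j"
    unfolding rule_def by (intro exI[of _ i] exI[of _ x]) simp
qed

section \<open>The switching maps along the sides\<close>

locale triangle =
  fixes lam mu :: "real ^ 3"
  assumes lam: "\<And>i. 0 < lam $ i" and gt: "\<And>i. lam $ i < mu $ i"
begin

lemma fmap_nth:
  "fmap lam mu j z $ l = (if l = j then 0 else ((mu $ j - lam $ j) * z $ l + lam $ l * z $ j) /
    ((mu $ j - lam $ j) + (lam $ 1 + lam $ 2 + lam $ 3 - mu $ j) * z $ j))"
proof -
  have "mu $ j \<noteq> 0" using lam[of j] gt[of j] by simp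
  then have "mu $ j * theta lam mu j = lam $ 1 + lam $ 2 + lam $ 3 - mu $ j"
    by (simp add: theta_def right_diff_distrib)
  moreover have "(\<Sum>i\<in>UNIV - {j}. f i *\<^sub>R ebasis i) $ l = (if l = j then 0 else f l)" for f
  proof -
    have "(\<Sum>i\<in>UNIV - {j}. f i *\<^sub>R ebasis i) $ l = (\<Sum>i\<in>UNIV - {j}. if l = i then f i else 0)"
      unfolding sum_component by (rule sum.cong) (simp_all add: ebasis_def axis_def)
    then show ?thesis by simp
  qed
  ultimately show ?thesis by (simp only: fmap_def)
qed

lemma fmap_next:
  assumes "0 \<le> x" "x < 1"
  shows "fmap lam mu (i + 1) (sidept x i) =
    sidept (lam $ i * (1 - x) / ((mu $ (i+1) - lam $ (i+1)) * x + (lam $ i + lam $ (i+2)) * (1 - x))) (i + 1)"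
proof -
  have "0 < lam $ i * (1 - x)" "0 < lam $ (i+2) * (1 - x)" "0 \<le> (mu $ (i+1) - lam $ (i+1)) * x"
    using assms lam gt[of "i+1"] by simp_all
  then have pos: "0 < (mu $ (i+1) - lam $ (i+1)) * x + (lam $ i + lam $ (i+2)) * (1 - x)"
    by (simp add: algebra_simps)
  \<comment> \<open>With weights \<open>x\<close> and \<open>1 - x\<close> the denominator is a
    combination of positive numbers, hence positive.\<close>
  have *: "mu $ (i+1) - lam $ (i+1) + (lam $ 1 + lam $ 2 + lam $ 3 - mu $ (i+1)) * (1 - x) =
    (mu $ (i+1) - lam $ (i+1)) * x + (lam $ i + lam $ (i+2)) * (1 - x)"
    unfolding sum_3_cyclic[of lam i] by (simp add: algebra_simps)
  show ?thesis
    unfolding vec_eq_iff forall_3_cyclic[of _ i] fmap_nth sidept_nth shift_3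
    using pos by (simp only: shift_3_neq * if_True if_False simp_thms) (simp add: field_simps)
qed

lemma fmap_prev:
  assumes "0 < x" "x \<le> 1"
  shows "fmap lam mu (i + 2) (sidept x i) =
    sidept (1 - lam $ i * x / ((mu $ (i+2) - lam $ (i+2)) * (1 - x) + (lam $ i + lam $ (i+1)) * x)) (i + 2)"
proof -
  have "0 < lam $ i * x" "0 < lam $ (i+1) * x" "0 \<le> (mu $ (i+2) - lam $ (i+2)) * (1 - x)"
    using assms lam gt[of "i+2"] by simp_all
  then have pos: "0 < (mu $ (i+2) - lam $ (i+2)) * (1 - x) + (lam $ i + lam $ (i+1)) * x"
    by (simp add: algebra_simps)
  have *: "mu $ (i+2) - lam $ (i+2) + (lam $ 1 + lam $ 2 + lam $ 3 - mu $ (i+2)) * x =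
    (mu $ (i+2) - lam $ (i+2)) * (1 - x) + (lam $ i + lam $ (i+1)) * x"
    unfolding sum_3_cyclic[of lam i] by (simp add: algebra_simps)
  show ?thesis
    unfolding vec_eq_iff forall_3_cyclic[of _ i] fmap_nth sidept_nth shift_3
    using pos by (simp only: shift_3_neq * if_True if_False simp_thms) (simp add: field_simps)
qed

section \<open>Conjugacy with the branches\<close>

definition emb :: "3 \<times> real \<Rightarrow> pt3" where
  "emb s = sidept (sigm (snd s)) (fst s)"

lemma emb_inject: "emb s = emb s' \<longleftrightarrow> s = s'"
  using sidept_inject[OF sigm_bounds, of "snd s" "fst s" "sigm (snd s')" "fst s'"]
  by (auto simp: emb_def prod_eq_iff sigm_inject)

lemma Sides_emb: "Sides (emb s) = {fst s}"
  by (auto simp: Sides_def emb_def sidept_in_A0i_iff sigm_bounds)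

lemma sidept_in_range_emb:
  assumes "0 < x" "x < 1"
  shows "sidept x i \<in> range emb"
  using assms by (auto simp: emb_def sigm_logodds intro!: range_eqI[of _ _ "(i, logodds x)"])

text \<open>The cut-off \<open>min _ M\<close> is inactive on the allowed arguments when all decision points have
  log-odds of modulus at most \<open>M\<close>; it makes each branch a contraction of the whole line.\<close>
definition branch :: "real \<Rightarrow> 3 \<Rightarrow> bool \<Rightarrow> real \<Rightarrow> real" where
  "branch M i b u = (if b
     then log_affine (lam $ (i+2)) (mu $ (i+1) - lam $ (i+1)) (min (- u) M) - ln (lam $ i)
     else ln (lam $ i) - log_affine (lam $ (i+1)) (mu $ (i+2) - lam $ (i+2)) (min u M))"

text \<open>Both maps are linear fractional in \<open>x\<close>. For \<open>True\<close> the odds of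
  the image are affine in the inverse odds of the argument; for \<open>False\<close> the inverse
  odds of the image are affine in the odds. Taking logarithms yields
  \<open>log_affine\<close>.\<close>

lemma fmap_emb:
  assumes "\<bar>e\<bar> \<le> M" "ok e b u"
  shows "fmap lam mu (nx i b) (emb (i, u)) = emb (nx i b, branch M i b u)"
proof (cases b)
  case True
  let ?p = "lam $ (i+2)" and ?q = "mu $ (i+1) - lam $ (i+1)" and ?l = "lam $ i" and ?E = "exp u"
  have pos: "0 < ?p" "0 < ?q" "0 < ?l" using lam gt by simp_all
  have u: "- u \<le> M" using assms True by (simp add: ok_def)
  have pe: "0 < ?p + ?q * exp (- u)" using pos by (simp add: add_pos_pos)
  have E: "0 < ?E" "0 < 1 + ?E" by (simp_all add: add_pos_pos)
  have s: "sigm (branch M i b u) = ?l / (?l + ?p + ?q * exp (- u))"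
    using True u pos pe
    by (simp add: branch_def sigm_def log_affine_def exp_diff exp_ln min_absorb1 field_simps)
  have x: "1 - sigm u = ?E * sigm u" "0 < sigm u" using E by (simp_all add: sigm_def field_simps)
  have "?l * (1 - sigm u) / (?q * sigm u + (?l + ?p) * (1 - sigm u)) =
    (?l * ?E) * sigm u / ((?q + (?l + ?p) * ?E) * sigm u)"
    unfolding x(1) by (simp add: algebra_simps)
  also have "\<dots> = ?l * ?E / (?q + (?l + ?p) * ?E)" using x by simp
  also have "\<dots> = ?l / (?l + ?p + ?q * exp (- u))"
    using E pos by (simp add: exp_minus field_simps add_pos_pos)
  finally show ?thesis
    using True s fmap_next[of "sigm u" i] sigm_bounds[of u] by (simp add: emb_def nx_def)
next
  case False
  let ?p = "lam $ (i+1)" and ?q = "mu $ (i+2) - lam $ (i+2)" and ?l = "lam $ i" and ?E = "exp u"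
  have pos: "0 < ?p" "0 < ?q" "0 < ?l" using lam gt by simp_all
  have u: "u \<le> M" using assms False by (simp add: ok_def)
  have pe: "0 < ?p + ?q * ?E" using pos by (simp add: add_pos_pos)
  have E: "0 < ?E" "0 < 1 + ?E" by (simp_all add: add_pos_pos)
  have s: "sigm (branch M i b u) = 1 - ?l / (?l + ?p + ?q * ?E)"
    using False u pos pe
    by (simp add: branch_def sigm_def log_affine_def exp_diff exp_ln min_absorb1 field_simps)
  have x: "1 - sigm u = ?E * sigm u" "0 < sigm u" using E by (simp_all add: sigm_def field_simps)
  have "?l * sigm u / (?q * (1 - sigm u) + (?l + ?p) * sigm u) =
    ?l * sigm u / ((?l + ?p + ?q * ?E) * sigm u)"
    unfolding x(1) by (simp add: algebra_simps)
  also have "\<dots> = ?l / (?l + ?p + ?q * ?E)" using x by simp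
  finally show ?thesis
    using False s fmap_prev[of "sigm u" i] sigm_bounds[of u] by (simp add: emb_def nx_def)
qed

text \<open>Choice \<open>i + 1\<close> needs \<open>x \<le> d $ i < 1\<close> and choice
  \<open>i + 2\<close> needs \<open>0 < d $ i \<le> x\<close>. This excludes the endpoint that the
  chosen map could send to a corner, so one step leads into the interior of a side, even from a
  corner.\<close>

lemma phi_range:
  assumes d: "d \<in> box 0 1" and z': "z' \<in> phi lam mu d z"
  shows "z' \<in> range emb"
proof -
  obtain j where j: "z' = fmap lam mu j z" "rule d z j" using z' by (auto simp: phi_def)
  then obtain i x where x: "0 \<le> x" "x \<le> 1" "z = sidept x i"
    "x \<le> d $ i \<and> j = i + 1 \<or> d $ i \<le> x \<and> j = i + 2"
    by (auto simp: rule_def)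
  have di: "0 < d $ i" "d $ i < 1" using d by (auto simp: mem_box_cart)
  from x(4) show ?thesis
  proof
    assume "x \<le> d $ i \<and> j = i + 1"
    then have *: "x < 1" "j = i + 1" using di by auto
    have "0 < lam $ i * (1 - x)" "0 < lam $ (i+2) * (1 - x)" "0 \<le> (mu $ (i+1) - lam $ (i+1)) * x"
      using * x lam gt[of "i+1"] by simp_all
    then show ?thesis
      unfolding j(1) x(3) *(2) fmap_next[OF x(1) *(1)]
      by (intro sidept_in_range_emb) (simp_all add: field_simps)
  next
    assume "d $ i \<le> x \<and> j = i + 2"
    then have *: "0 < x" "j = i + 2" using di by auto
    have "0 < lam $ i * x" "0 < lam $ (i+1) * x" "0 \<le> (mu $ (i+2) - lam $ (i+2)) * (1 - x)"
      using * x lam gt[of "i+2"] by simp_all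
    then show ?thesis
      unfolding j(1) x(3) *(2) fmap_prev[OF *(1) x(2)]
      by (intro sidept_in_range_emb) (simp_all add: field_simps)
  qed
qed

lemma branch_contracting:
  obtains c L where "contracting_branches (branch M) c L M"
proof -
  \<comment> \<open>This is the derivative of \<open>log_affine p q\<close> at \<open>M\<close>, its
    largest value on the range left by the cut-off.\<close>
  define ratio where "ratio p q = q * exp M / (p + q * exp M)" for p q :: real
  let ?c = "\<lambda>(i, b). if b then ratio (lam $ (i+2)) (mu $ (i+1) - lam $ (i+1))
    else ratio (lam $ (i+1)) (mu $ (i+2) - lam $ (i+2))"
  let ?B = "\<lambda>p q. \<bar>ln p\<bar> + \<bar>log_affine p q M\<bar>"
  let ?L = "\<lambda>(i, b). \<bar>ln (lam $ i)\<bar> + (if b then ?B (lam $ (i+2)) (mu $ (i+1) - lam $ (i+1))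
    else ?B (lam $ (i+1)) (mu $ (i+2) - lam $ (i+2)))"
  define c where "c = Max (range ?c)"
  define L where "L = Max (range ?L)"
  have pos: "0 < mu $ i - lam $ i" for i using gt by simp
  have ratio: "0 < ratio p q \<and> ratio p q < 1" if "0 < p" "0 < q" for p q
    using that by (simp add: ratio_def add_pos_pos)
  have c_ge: "?c (i, b) \<le> c" and L_ge: "?L (i, b) \<le> L" for i b
    unfolding c_def L_def by (rule Max_ge[OF _ rangeI]; simp)+
  have "contracting_branches (branch M) c L M"
  proof
    have "c \<in> range ?c" unfolding c_def by (rule Max_in) auto
    then show "0 < c" "c < 1" using ratio lam pos by (auto split: if_splits)
    fix i j :: 3 and b and u v e :: real
    show "\<bar>branch M i b u - branch M i b v\<bar> \<le> c * \<bar>u - v\<bar>"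
    proof -
      have min: "\<bar>min x M - min y M\<bar> \<le> \<bar>x - y\<bar>" for x y :: real by linarith
      have *: "\<bar>log_affine p q (min x M) - log_affine p q (min y M)\<bar> \<le> c * \<bar>x - y\<bar>"
        if "0 < p" "0 < q" "ratio p q \<le> c" for p q x y
      proof -
        have "\<bar>log_affine p q (min x M) - log_affine p q (min y M)\<bar> \<le> ratio p q * \<bar>min x M - min y M\<bar>"
          unfolding ratio_def using that by (intro log_affine_lip) auto
        also have "\<dots> \<le> c * \<bar>x - y\<bar>"
          using that min ratio[of p q] by (intro mult_mono) auto
        finally show ?thesis .
      qed
      show ?thesis
      proof (cases b)
        case True
        with *[of "lam $ (i+2)" "mu $ (i+1) - lam $ (i+1)" "-u" "-v"] c_ge[of i True] lam pos
        show ?thesis by (simp add: branch_def abs_minus_commute)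
      next
        case False
        with *[of "lam $ (i+1)" "mu $ (i+2) - lam $ (i+2)" u v] c_ge[of i False] lam pos
        show ?thesis by (simp add: branch_def abs_minus_commute)
      qed
    qed
    show "\<bar>branch M i b u\<bar> \<le> L"
    proof (cases b)
      case True
      have "\<bar>log_affine (lam $ (i+2)) (mu $ (i+1) - lam $ (i+1)) (min (-u) M)\<bar>
          \<le> ?B (lam $ (i+2)) (mu $ (i+1) - lam $ (i+1))"
        by (intro log_affine_bound lam pos) simp
      with True L_ge[of i True] show ?thesis by (simp add: branch_def)
    next
      case False
      have "\<bar>log_affine (lam $ (i+1)) (mu $ (i+2) - lam $ (i+2)) (min u M)\<bar>
          \<le> ?B (lam $ (i+1)) (mu $ (i+2) - lam $ (i+2))"
        by (intro log_affine_bound lam pos) simp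
      with False L_ge[of i False] show ?thesis by (simp add: branch_def)
    qed
    show "u = v" if "\<bar>e\<bar> \<le> M" "ok e b u" "ok e b v" "branch M i b u = branch M i b v"
    proof (cases b)
      case True
      then have "min (-u) M = -u" "min (-v) M = -v" using that by (auto simp: ok_def)
      with True that(4) show ?thesis by (simp add: branch_def log_affine_inject[OF lam pos])
    next
      case False
      then have "min u M = u" "min v M = v" using that by (auto simp: ok_def)
      with False that(4) show ?thesis by (simp add: branch_def log_affine_inject[OF lam pos])
    qed
    \<comment> \<open>The images lie strictly on opposite sides of the common value
      \<open>ln (lam $ (i+2)) - ln (lam $ i)\<close>.\<close>
    show "branch M i True u \<noteq> branch M j False v" if "i + 1 = j + 2"
    proof -
      have "i = j + 1" using that exhaust_3[of j] by (auto simp: eq_diff_eq[symmetric])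
      then have ij: "j = i + 2" "j + 1 = i" using exhaust_3[of j] by auto
      have "ln (lam $ (i+2)) - ln (lam $ i) < branch M i True u"
        using log_affine_gt[OF lam pos] by (simp add: branch_def)
      moreover have "branch M j False v < ln (lam $ j) - ln (lam $ (j+1))"
        using log_affine_gt[OF lam pos] by (simp add: branch_def)
      ultimately show ?thesis unfolding ij(2) ij(1)[symmetric] by linarith
    qed
  qed
  then show ?thesis by (rule that)
qed

end

section \<open>Asymptotic periodicity\<close>

text \<open>If an entry occurs at positions \<open>i < j\<close>, walking on from both shows that
  the list is invariant under rotation by \<open>j - i\<close>. Its two parts then commute as words
  and so are powers of one word, which contradicts primitivity.\<close>

lemma primitive_distinct:
  assumes "\<not> distinct us" "primitive_list us"
    and determ: "\<And>i j t. us ! (i mod length us) = us ! (j mod length us) \<Longrightarrow>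
      us ! ((i + t) mod length us) = us ! ((j + t) mod length us)"
  shows False
proof -
  let ?n = "length us"
  obtain i j where ij: "i < j" "j < ?n" "us ! i = us ! j"
    using assms(1) by (metis distinct_conv_nth linorder_neqE_nat)
  define q where "q = j - i"
  have q: "0 < q" "q < ?n" using ij by (auto simp: q_def)
  have rot: "us ! ((q + t) mod ?n) = us ! t" if "t < ?n" for t
  proof -
    have "us ! (i mod ?n) = us ! (j mod ?n)" using ij by simp
    then have "us ! ((i + (t + ?n - i)) mod ?n) = us ! ((j + (t + ?n - i)) mod ?n)"
      by (rule determ)
    moreover have "i + (t + ?n - i) = t + ?n" "j + (t + ?n - i) = (q + t) + ?n"
      using ij by (auto simp: q_def)
    ultimately show ?thesis using that by simp
  qed
  have "rotate q us = us"
    by (rule nth_equalityI) (simp_all add: nth_rotate rot)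
  then have "drop q us @ take q us = take q us @ drop q us"
    using q by (simp add: rotate_drop_take)
  moreover have "take q us \<noteq> []" "drop q us \<noteq> []" using q by auto
  ultimately obtain m ws where "1 < m" "concat (replicate m ws) = take q us @ drop q us"
    using comm_append_is_replicate[of "take q us" "drop q us"] by auto
  then have "2 \<le> m" "us = concat (replicate m ws)" by auto
  then show False using assms(2) unfolding primitive_list_def by blast
qed

section \<open>Transfer to the triangle process\<close>

context triangle
begin

lemma isCont_emb: "isCont (\<lambda>u. emb (i, u)) u"
  unfolding emb_def sidept_def fst_conv snd_conv
  by (intro continuous_intros isCont_sigm)

lemma dist1_tendsto:
  assumes "x \<longlonglongrightarrow> u"
  shows "(\<lambda>t. dist1 (emb (i, x t)) (emb (i, u))) \<longlonglongrightarrow> 0"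
proof -
  have "(\<lambda>t. emb (i, x t)) \<longlonglongrightarrow> emb (i, u)"
    using isCont_emb assms by (rule isCont_tendsto_compose)
  then have "(\<lambda>t. norm (emb (i, x t) - emb (i, u)) / sqrt 2) \<longlonglongrightarrow> 0 / sqrt 2"
    by (intro tendsto_divide tendsto_norm_zero tendsto_const) (simp_all add: LIM_zero)
  then show ?thesis by (simp add: dist1_def)
qed

lemma triangle_dynamics:
  fixes d :: pt3
  defines "D \<equiv> \<lambda>i. logodds (d $ i)"
  assumes "contracting_branches (branch M) c L M"
    and d: "d \<in> box 0 1" and DM: "\<And>i. \<bar>D i\<bar> \<le> M"
    and \<epsilon>: "0 < \<epsilon>"
    and sep: "contracting_branches.separated (branch M) D \<epsilon> m"
  shows "finite {us. periodic_orbit lam mu d us \<and> primitive_list us} \<and>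
    (\<forall>z. trajectory lam mu d z \<longrightarrow> eventually_periodic z \<and>
      (\<exists>us. periodic_orbit lam mu d us \<and> converges_onto z us))"
proof -
  interpret contracting_branches "branch M" c L M by fact
  have phi_emb: "emb s' \<in> phi lam mu d (emb s) \<longleftrightarrow> step D s s'" for s s'
  proof -
    obtain i u where s: "s = (i, u)" by (cases s)
    have di: "0 < d $ i" "d $ i < 1" using d by (auto simp: mem_box_cart)
    have "sigm u \<le> d $ i \<longleftrightarrow> D i \<le> u" "d $ i \<le> sigm u \<longleftrightarrow> u \<le> D i"
      using sigm_le_iff[of u "D i"] sigm_le_iff[of "D i" u] sigm_logodds[OF di] by (simp_all add: D_def)
    then have rule: "rule d (emb s) j \<longleftrightarrow> (\<exists>b. j = nx i b \<and> ok (D i) b u)" for j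
      by (auto simp: s emb_def rule_sidept sigm_bounds nx_def ok_def)
    have "emb s' \<in> phi lam mu d (emb s) \<longleftrightarrow>
        (\<exists>b. ok (D i) b u \<and> emb s' = fmap lam mu (nx i b) (emb (i, u)))"
      using rule unfolding phi_def s by auto
    also have "\<dots> \<longleftrightarrow> (\<exists>b. ok (D i) b u \<and> emb s' = emb (nx i b, branch M i b u))"
      using fmap_emb[OF DM] by metis
    finally show ?thesis by (simp add: step_def s emb_inject)
  qed
  have lift: "\<exists>s. orbit D s \<and> (\<forall>t. z t = emb (s t))"
    if "\<And>t. z t \<in> range emb" "\<And>t. z (Suc t) \<in> phi lam mu d (z t)" for z
  proof -
    from that(1) have "\<forall>t. \<exists>s. z t = emb s" by (meson rangeE)
    then obtain s where s: "\<And>t. z t = emb (s t)" by metis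
    with that(2) phi_emb have "orbit D s" unfolding orbit_def by metis
    with s show ?thesis by blast
  qed
  have "finite {us. periodic_orbit lam mu d us \<and> primitive_list us}"
  proof (rule finite_subset)
    \<comment> \<open>A primitive periodic orbit is a list without repetitions over this finite set
      of states.\<close>
    let ?P = "(\<lambda>s. emb (s 0)) ` {s. periodic D s}"
    show "finite {us. set us \<subseteq> ?P \<and> distinct us}"
      using finite_periodic[OF \<epsilon> sep] by (intro finite_subset_distinct finite_imageI)
    show "{us. periodic_orbit lam mu d us \<and> primitive_list us} \<subseteq> {us. set us \<subseteq> ?P \<and> distinct us}"
    proof clarify
      fix us assume us: "periodic_orbit lam mu d us" "primitive_list us"
      let ?n = "length us"
      have n: "0 < ?n" using us(1) by (simp add: periodic_orbit_def)
      define z where "z t = us ! (t mod ?n)" for t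
      have succ: "z (Suc t) \<in> phi lam mu d (z t)" for t
      proof (cases "Suc (t mod ?n) = ?n")
        case True
        then have "Suc t mod ?n = 0" "t mod ?n = ?n - 1" by (auto simp: mod_Suc)
        then show ?thesis
          using us(1) hd_conv_nth[of us] last_conv_nth[of us] by (simp add: z_def periodic_orbit_def)
      next
        case False
        then have "Suc (t mod ?n) < ?n" using n by (simp add: Suc_lessI)
        with False show ?thesis
          using us(1) by (simp add: z_def periodic_orbit_def mod_Suc)
      qed
      have "z t \<in> range emb" for t
      proof -
        \<comment> \<open>Going once around the cycle shows every entry to be an image, hence
          interior to a side.\<close>
        have "z (Suc (t + ?n - 1)) \<in> range emb" using phi_range[OF d succ] .
        then show ?thesis using n by (simp add: z_def)
      qed
      then obtain s where s: "orbit D s" "\<And>t. z t = emb (s t)"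
        using lift succ by blast
      have sn: "s (t + ?n) = s t" for t
        using s(2)[of t] s(2)[of "t + ?n"] by (simp add: z_def emb_inject)
      have per: "periodic D (\<lambda>t. s (t + r))" for r
      proof -
        have "s (t + ?n + r) = s (t + r)" for t
          using sn[of "t + r"] by (simp only: add.assoc add.commute[of r])
        then show ?thesis
          unfolding periodic_def using orbit_shift[OF s(1)] n by blast
      qed
      show "set us \<subseteq> ?P \<and> distinct us"
      proof
        show "set us \<subseteq> ?P"
        proof
          fix y assume "y \<in> set us"
          then obtain i where "i < ?n" "y = us ! i" by (metis in_set_conv_nth)
          then have "y = emb (s (0 + i))" using s(2)[of i] by (simp add: z_def)
          with per[of i] show "y \<in> ?P" by (intro image_eqI[of _ _ "\<lambda>t. s (t + i)"]) auto
        qed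
        show "distinct us"
        proof (rule ccontr)
          assume "\<not> distinct us"
          then show False
          proof (rule primitive_distinct[OF _ us(2)])
            fix i j t assume "us ! (i mod ?n) = us ! (j mod ?n)"
            then have "s i = s j" using s(2)[of i] s(2)[of j] by (simp add: z_def emb_inject)
            then have "(\<lambda>t. s (t + i)) = (\<lambda>t. s (t + j))"
              by (intro periodic_eq[OF \<epsilon> sep per per]) simp_all
            then have "s (t + i) = s (t + j)" by (rule fun_cong)
            then show "us ! ((i + t) mod ?n) = us ! ((j + t) mod ?n)"
              using s(2)[of "t + i"] s(2)[of "t + j"] by (simp add: z_def add.commute)
          qed
        qed
      qed
    qed
  qed
  moreover have "eventually_periodic z \<and> (\<exists>us. periodic_orbit lam mu d us \<and> converges_onto z us)"
    if z: "trajectory lam mu d z" for z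
  proof -
    have succ: "z (Suc t) \<in> phi lam mu d (z t)" for t using z by (simp add: trajectory_def)
    \<comment> \<open>The initial state may be a corner, which has no log-odds. Hence
      \<open>s t\<close> encodes \<open>z (Suc t)\<close>, and \<open>Suc r\<close> appears
      below.\<close>
    then have "z (Suc t) \<in> range emb" for t using phi_range[OF d] by blast
    then obtain s where s: "orbit D s" "\<And>t. z (Suc t) = emb (s t)"
      using lift[of "\<lambda>t. z (Suc t)"] succ by blast
    obtain p v r where v: "0 < p" "orbit D v" "\<And>n. v (n + p) = v n"
      "\<And>n t. fst (s (r + n + p * t)) = fst (v n)"
      "\<And>n. (\<lambda>t. snd (s (r + n + p * t))) \<longlonglongrightarrow> snd (v n)"
      using orbit_converges[OF \<epsilon> sep s(1)] by metis
    have "Sides (z (n + p)) = Sides (z n)" if "Suc r \<le> n" for n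
    proof -
      define n' where "n' = n - Suc r"
      have n: "n = Suc (r + n')" using that by (simp add: n'_def)
      have "fst (s (r + n' + p)) = fst (s (r + n'))" using v(4)[of n' 0] v(4)[of n' 1] by simp
      then show ?thesis using s(2)[of "r + n'"] s(2)[of "r + n' + p"] by (simp add: n Sides_emb)
    qed
    then have ev: "eventually_periodic z"
      unfolding eventually_periodic_def eventually_m_periodic_def using v(1)
      by (intro exI[of _ p] conjI exI[of _ "Suc r"]) auto
    define us where "us = map (\<lambda>n. emb (v n)) [0..<p]"
    have "emb (v (Suc n)) \<in> phi lam mu d (emb (v n))" for n
      using v(2) phi_emb by (simp add: orbit_def)
    note succ_v = this
    have "us \<noteq> []" using v(1) by (simp add: us_def)
    moreover have "hd us = emb (v (Suc (p - 1)))" "last us = emb (v (p - 1))"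
      using v(1) v(3)[of 0] by (simp_all add: us_def hd_conv_nth last_conv_nth)
    ultimately have per: "periodic_orbit lam mu d us"
      unfolding periodic_orbit_def using succ_v succ_v[of "p - 1"] v(1) by (simp add: us_def)
    have "converges_onto z us"
      unfolding converges_onto_def
    proof (intro exI[of _ "Suc r"] allI impI)
      fix n assume "n < length us"
      then have n: "n < p" by (simp add: us_def)
      have "z (p * t + n + Suc r) = emb (fst (v n), snd (s (r + n + p * t)))" for t
      proof -
        have "p * t + n + Suc r = Suc (r + n + p * t)" by simp
        then have "z (p * t + n + Suc r) = emb (s (r + n + p * t))" by (simp only: s(2))
        also have "s (r + n + p * t) = (fst (v n), snd (s (r + n + p * t)))"
          using v(4)[of n t] by (simp only: prod_eq_iff fst_conv snd_conv)
        finally show ?thesis .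
      qed
      then show "(\<lambda>t. dist1 (z (length us * t + n + Suc r)) (us ! n)) \<longlonglongrightarrow> 0"
        using dist1_tendsto[OF v(5)[of n], of "fst (v n)"] n by (simp add: us_def)
    qed
    with ev per show ?thesis by blast
  qed
  ultimately show ?thesis by blast
qed

end

theorem theorem3p1:
  fixes lam mu :: "real ^ 3"
  assumes "\<forall>i. lam$i > 0" and "\<forall>i. mu$i > 0"
    and "\<forall>i. lam$i / mu$i < 1"
    and "lam$1 / mu$1 + lam$2 / mu$2 + lam$3 / mu$3 > 1"
  shows "AE d in lborel. d \<in> box 0 1 \<longrightarrow>
           finite {us. periodic_orbit lam mu d us \<and> primitive_list us} \<and>
           (\<forall>z. trajectory lam mu d z \<longrightarrow>
              eventually_periodic z \<and>
              (\<exists>us. periodic_orbit lam mu d us \<and> converges_onto z us))"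
    (is "AE d in lborel. _ \<longrightarrow> ?Q d")
proof -
  interpret triangle lam mu
    using assms(1-3) by unfold_locales auto
  \<comment> \<open>The contraction factor tends to 1 as decision points approach the corners, so
    the cube is exhausted by countably many parts with log-odds bounded by \<open>M\<close>.\<close>
  have "\<forall>M :: nat. \<exists>S. negligible S \<and>
    (\<forall>d \<in> box 0 1 - S. (\<forall>i. \<bar>logodds (d $ i)\<bar> \<le> real M) \<longrightarrow> ?Q d)"
  proof
    fix M :: nat
    obtain c L where cb: "contracting_branches (branch M) c L M"
      using branch_contracting .
    obtain S :: "(real ^ 3) set" where S: "negligible S"
      "\<forall>d \<in> box 0 1 - S. (\<forall>i. \<bar>logodds (d $ i)\<bar> \<le> M) \<longrightarrow>
        (\<exists>\<epsilon> m. 0 < \<epsilon> \<and> contracting_branches.separated (branch M) (\<lambda>i. logodds (d $ i)) \<epsilon> m)"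
      using contracting_branches.gap_almost_everywhere[OF cb] by (elim exE conjE)
    have "\<forall>d \<in> box 0 1 - S. (\<forall>i. \<bar>logodds (d $ i)\<bar> \<le> real M) \<longrightarrow> ?Q d"
    proof (intro ballI impI)
      fix d assume d: "d \<in> box 0 1 - S" "\<forall>i. \<bar>logodds (d $ i)\<bar> \<le> real M"
      obtain \<epsilon> m where "0 < \<epsilon>"
        "contracting_branches.separated (branch M) (\<lambda>i. logodds (d $ i)) \<epsilon> m"
        using S(2) d by blast
      with d show "?Q d" by (intro triangle_dynamics[OF cb]) auto
    qed
    with S(1) show "\<exists>S. negligible S \<and>
      (\<forall>d \<in> box 0 1 - S. (\<forall>i. \<bar>logodds (d $ i)\<bar> \<le> real M) \<longrightarrow> ?Q d)"
      by (intro exI[of _ S] conjI)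
  qed
  from choice[OF this] obtain S where S: "\<forall>M. negligible (S M) \<and>
    (\<forall>d \<in> box 0 1 - S M. (\<forall>i. \<bar>logodds (d $ i)\<bar> \<le> real M) \<longrightarrow> ?Q d)" ..
  have "negligible (\<Union>M. S M)" using S by (intro negligible_countable_Union) auto
  then have "AE d in lebesgue. d \<notin> (\<Union>M. S M)"
    by (intro AE_not_in) (simp add: negligible_iff_null_sets)
  then have "AE d in lborel. d \<notin> (\<Union>M. S M)"
    by (simp add: AE_completion_iff)
  then show ?thesis
  proof (rule AE_mp, intro AE_I2 impI)
    fix d assume d: "d \<notin> (\<Union>M. S M)" "d \<in> box 0 1"
    obtain M :: nat where "(\<Sum>i\<in>UNIV. \<bar>logodds (d $ i)\<bar>) \<le> M"
      using real_arch_simple by blast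
    then have "\<forall>i. \<bar>logodds (d $ i)\<bar> \<le> real M"
      using member_le_sum[of _ UNIV "\<lambda>i. \<bar>logodds (d $ i)\<bar>"] by (meson UNIV_I abs_ge_zero finite order_trans)
    moreover have "d \<in> box 0 1 - S M" using d by simp
    ultimately show "?Q d" using S by (elim allE[of _ M] conjE) (drule (1) bspec, drule (1) mp)
  qed
qed

end
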